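(* Let $(\boldsymbol{\pi},\boldsymbol{T},\boldsymbol{R})$ be a representation for a multivariate phase-type distribution of $\mathrm{MPH}^*$ type on $\mathbb{R}_+^n$, and let $0<\alpha_i\le 1$ for $i=1,\dots,n$. Then the function $$\phi(\boldsymbol{u})=\boldsymbol{\pi}\left(\boldsymbol{\Delta}(\boldsymbol{R}\boldsymbol{u}^{\boldsymbol{\alpha}})-\boldsymbol{T}\right)^{-1}\boldsymbol{t},\qquad \boldsymbol{u}\in\mathbb{R}_+^n,$$ with $\boldsymbol{u}^{\boldsymbol{\alpha}}=(u_1^{\alpha_1},\dots,u_n^{\alpha_n})$, is a multidimensional Laplace transform, i.e. there is a random vector $\boldsymbol{X}$ with values in $\mathbb{R}_+^n$ such that $\phi(\boldsymbol{u})=\mathbb{E}(e^{-\langle\boldsymbol{u},\boldsymbol{X}\rangle})$ for all $\boldsymbol{u}\in\mathbb{R}_+^n$.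
   Context: $\mathbb{R}_+=[0,\infty)$. A phase-type representation $(\boldsymbol{\pi},\boldsymbol{T})$ of dimension $p$ consists of a probability row vector $\boldsymbol{\pi}=(\pi_1,\dots,\pi_p)$ and a $p\times p$ sub-intensity matrix $\boldsymbol{T}$, i.e. the restriction to the transient states $1,\dots,p$ of the intensity matrix of a Markov jump process on $\{1,\dots,p,p+1\}$ in which $1,\dots,p$ are transient and $p+1$ is absorbing (off-diagonal entries nonnegative, row sums nonpositive, $\boldsymbol{T}$ invertible). Put $\boldsymbol{t}=-\boldsymbol{T}\boldsymbol{e}$, where $\boldsymbol{e}$ is the column vector of ones. $\boldsymbol{\Delta}(\boldsymbol{a})$ denotes the diagonal matrix with the vector $\boldsymbol{a}$ on the diagonal. A representation $(\boldsymbol{\pi},\boldsymbol{T},\boldsymbol{R})$ of an $\mathrm{MPH}^*$ distribution consists of a phase-type representation $(\boldsymbol{\pi},\boldsymbol{T})$ of dimension $p$ and a $p\times n$ matrix $\boldsymbol{R}=\{r_{ik}\}$ with nonnegative entries. With $\{X_t\}$ the Markov jump process with initial distribution $\boldsymbol{\pi}$ and sub-intensity matrix $\boldsymbol{T}$, and $\tau$ its absorption time, the $\mathrm{MPH}^*(\boldsymbol{\pi},\boldsymbol{T},\boldsymbol{R})$ distribution is that of $(W_1,\dots,W_n)$ with $W_k=\int_0^\tau\sum_{i=1}^p 1\{X_t=i\}\,r_{ik}\,dt$; its joint Laplace transform is $\boldsymbol{\pi}(\boldsymbol{\Delta}(\boldsymbol{R}\boldsymbol{u})-\boldsymbol{T})^{-1}\boldsymbol{t}$,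 $\boldsymbol{u}\in\mathbb{R}_+^n$ (vectors $\boldsymbol u$ and $\boldsymbol u^{\boldsymbol\alpha}$ multiplied by $\boldsymbol R$ are regarded as column vectors). *)

theory Defs
  imports "HOL-Probability.Probability"
begin

text \<open>
  The index types \<open>'p\<close> (transient states) and \<open>'n\<close> (coordinates of the random vector) are finite and
  nonempty, so the dimensions \<open>p = CARD('p)\<close> and \<open>n = CARD('n)\<close> are arbitrary positive integers.
\<close>

definition nonneg_orthant :: "(real ^ 'n) set"
  where "nonneg_orthant = {u. \<forall>k. 0 \<le> u $ k}"

definition diag_matrix :: "real ^ 'p \<Rightarrow> real ^ 'p ^ 'p"
  where "diag_matrix a = (\<chi> i j. if i = j then a $ i else 0)"

definition vec_powr :: "real ^ 'n \<Rightarrow> real ^ 'n \<Rightarrow> real ^ 'n"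
  where "vec_powr u \<alpha> = (\<chi> k. u $ k powr \<alpha> $ k)"

definition prob_vector :: "real ^ 'p \<Rightarrow> bool"
  where "prob_vector \<pi> \<longleftrightarrow> (\<forall>i. 0 \<le> \<pi> $ i) \<and> (\<Sum>i\<in>UNIV. \<pi> $ i) = 1"

text \<open>
  Invertibility expresses that every state of \<open>'p\<close> is transient, i.e. that absorption is certain
  from each of them.
\<close>

definition sub_intensity_matrix :: "real ^ 'p ^ 'p \<Rightarrow> bool"
  where "sub_intensity_matrix T \<longleftrightarrow>
    (\<forall>i j. i \<noteq> j \<longrightarrow> 0 \<le> T $ i $ j) \<and> (\<forall>i. (\<Sum>j\<in>UNIV. T $ i $ j) \<le> 0) \<and> invertible T"

definition phase_type_representation :: "real ^ 'p \<Rightarrow> real ^ 'p ^ 'p \<Rightarrow> bool"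
  where "phase_type_representation \<pi> T \<longleftrightarrow> prob_vector \<pi> \<and> sub_intensity_matrix T"

definition MPH_star_representation ::
    "real ^ 'p \<Rightarrow> real ^ 'p ^ 'p \<Rightarrow> real ^ 'n ^ 'p \<Rightarrow> bool"
  where "MPH_star_representation \<pi> T R \<longleftrightarrow>
    phase_type_representation \<pi> T \<and> (\<forall>i k. 0 \<le> R $ i $ k)"

definition exit_vector :: "real ^ 'p ^ 'p \<Rightarrow> real ^ 'p"
  where "exit_vector T = - (T *v (\<chi> i. 1))"

text \<open>
  The underlying probability space may be taken to live on the type of the values of the random
  vector: any random vector can be replaced by the identity on its distribution.
\<close>

definition multidim_laplace_transform :: "(real ^ 'n \<Rightarrow> real) \<Rightarrow> bool"
  where "multidim_laplace_transform \<phi> \<longleftrightarrow>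
    (\<exists>(M :: (real ^ 'n) measure) X :: real ^ 'n \<Rightarrow> real ^ 'n.
       prob_space M \<and> X \<in> borel_measurable M \<and> (\<forall>\<omega>\<in>space M. X \<omega> \<in> nonneg_orthant) \<and>
       (\<forall>u\<in>nonneg_orthant. \<phi> u = (\<integral>\<omega>. exp (- (u \<bullet> X \<omega>)) \<partial>M)))"

end

theory Submission
  imports Defs
begin

text \<open>
  Let \<open>W\<close> be a random vector with the given MPH* distribution. The function in question is the Laplace
  transform of \<open>W\<close> evaluated at \<open>vec_powr u \<alpha>\<close>. If \<open>S\<^sub>1, \<dots>, S\<^sub>n\<close> are independent one-sided stable variables,
  independent of \<open>W\<close>, with \<open>E (exp (- (u * S\<^sub>k))) = exp (- (u powr \<alpha> $ k))\<close>, then conditioning on \<open>W\<close> shows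
  that the vector with the components \<open>(W $ k) powr (1 / \<alpha> $ k) * S\<^sub>k\<close> has exactly this transform
  (\<open>is_laplace_vec_powr\<close>). So two laws have to be constructed: that of \<open>W\<close> and the stable ones.

  Both constructions rest on the class of Laplace transforms of finite measures, which contains the
  nonnegative constants and is closed under products (convolution) and convergent series
  (countable sums of measures).

  The law of \<open>W\<close> is obtained without constructing the jump process. Uniformization writes
  the resolvent applied to the exit vector as a series, over the number of jumps, of sums of products of
  nonnegative constants and factors \<open>1 / (c + (R *v u) $ i)\<close>, and each such factor is the transform
  of a multiple of the law of an exponential variable times a fixed vector
  (\<open>is_laplace_absorption\<close>, \<open>is_laplace_MPH_star\<close>). The same series, evaluated without killing, shows that the matrix
  to be inverted is invertible and that the total mass is 1.

  For the stable law of index \<open>\<alpha> < 1\<close>, the binomial series of \<open>1 - (1 - z) powr \<alpha>\<close> has nonnegative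
  coefficients with sum 1. Setting \<open>z = exp (- (u / n))\<close> and composing with an exponential series shows
  that \<open>exp (- ((n * (1 - exp (- (u / n)))) powr \<alpha>))\<close> is a Laplace transform (\<open>is_laplace_stable_approx\<close>). As \<open>n\<close>
  grows this tends to \<open>exp (- (u powr \<alpha>))\<close>, and Helly's selection theorem provides the limit law
  (\<open>halfline_laplace_continuity\<close>, \<open>is_laplace_stable\<close>).
\<close>

section \<open>Laplace transforms of finite measures on an additive set\<close>

text \<open>
  A series of nonnegative set functions is again countably additive because nonnegative double series
  may be summed in either order; the formula for integrals then spreads from indicators to all
  measurable functions by monotone approximation.
\<close>

lemma countable_sum_of_measures:
  fixes N :: "nat \<Rightarrow> 'a measure"
  assumes sets_N: "\<And>m. sets (N m) = sets M"
  obtains S where "sets S = sets M"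
    and "\<And>f. f \<in> borel_measurable M \<Longrightarrow> (\<integral>\<^sup>+x. f x \<partial>S) = (\<Sum>m. \<integral>\<^sup>+x. f x \<partial>N m)"
proof
  define S where "S = measure_of (space M) (sets M) (\<lambda>A. \<Sum>m. emeasure (N m) A)"
  show sets_S: "sets S = sets M"
    by (simp add: S_def)
  note [measurable_cong] = sets_N
  have emeasure_S: "emeasure S A = (\<Sum>m. emeasure (N m) A)" if "A \<in> sets M" for A
    unfolding S_def
  proof (rule emeasure_measure_of_sigma)
    show "sigma_algebra (space M) (sets M)" ..
    show "positive (sets M) (\<lambda>A. \<Sum>m. emeasure (N m) A)"
      by (simp add: positive_def)
    show "countably_additive (sets M) (\<lambda>A. \<Sum>m. emeasure (N m) A)"
    proof (rule countably_additiveI)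
      fix A :: "nat \<Rightarrow> 'a set"
      assume A: "range A \<subseteq> sets M" "disjoint_family A"
      have "(\<Sum>i. \<Sum>m. emeasure (N m) (A i)) = (\<Sum>m. \<Sum>i. emeasure (N m) (A i))"
        by (simp only: nn_integral_count_space_nat[symmetric])
           (rule nn_integral_count_space_nn_integral[symmetric], auto)
      also have "\<dots> = (\<Sum>m. emeasure (N m) (\<Union>i. A i))"
        using A by (intro suminf_cong suminf_emeasure) (auto simp: sets_N)
      finally show "(\<Sum>i. \<Sum>m. emeasure (N m) (A i)) = (\<Sum>m. emeasure (N m) (\<Union>i. A i))" .
    qed
  qed (fact that)
  fix f :: "'a \<Rightarrow> ennreal"
  assume "f \<in> borel_measurable M"
  then show "(\<integral>\<^sup>+x. f x \<partial>S) = (\<Sum>m. \<integral>\<^sup>+x. f x \<partial>N m)"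
  proof induction
    case (cong f g)
    have "space S = space M" "\<And>m. space (N m) = space M"
      using sets_S sets_N by (auto dest: sets_eq_imp_space_eq)
    with cong show ?case
      by (metis (mono_tags, lifting) nn_integral_cong suminf_cong)
  next
    case (set A)
    then show ?case
      by (simp add: emeasure_S sets_S sets_N)
  next
    case (mult u c)
    note [measurable_cong] = sets_S and [measurable] = mult.hyps
    show ?case
      by (simp add: nn_integral_cmult mult.IH)
  next
    case (add u v)
    note [measurable_cong] = sets_S and [measurable] = add.hyps
    show ?case
      by (simp add: nn_integral_add add.IH suminf_add)
  next
    case (seq U)
    note [measurable_cong] = sets_S and [measurable] = seq.hyps(1)
    have "(\<integral>\<^sup>+x. (SUP i. U i x) \<partial>S) = (SUP i. \<Sum>m. \<integral>\<^sup>+x. U i x \<partial>N m)"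
      using seq by (subst nn_integral_monotone_convergence_SUP) auto
    also have "\<dots> = (\<Sum>m. SUP i. \<integral>\<^sup>+x. U i x \<partial>N m)"
    proof -
      have "incseq (\<lambda>i. (\<lambda>m. \<integral>\<^sup>+x. U i x \<partial>N m))"
        using seq.hyps by (auto simp: incseq_def le_fun_def intro!: nn_integral_mono)
      then show ?thesis
        by (simp only: nn_integral_count_space_nat[symmetric])
           (subst nn_integral_monotone_convergence_SUP; auto)
    qed
    also have "\<dots> = (\<Sum>m. \<integral>\<^sup>+x. (SUP i. U i x) \<partial>N m)"
      using seq by (subst nn_integral_monotone_convergence_SUP) auto
    moreover have "Sup (range U) = (\<lambda>x. SUP i. U i x)"
      by (simp add: fun_eq_iff image_comp)
    ultimately show ?case
      by simp
  qed
qed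

text \<open>
  One theory serves two cases: the half-line, on which the one-sided stable laws live, and the
  nonnegative orthant. Closure of \<open>C\<close> under addition is what keeps convolutions supported in \<open>C\<close>.
\<close>

locale laplace_domain =
  fixes C :: "'a::euclidean_space set"
  assumes borel_C [measurable]: "C \<in> sets borel"
    and zero_in_C: "0 \<in> C"
    and add_in_C: "x \<in> C \<Longrightarrow> y \<in> C \<Longrightarrow> x + y \<in> C"
begin

text \<open>
  With the nonnegative integral, series of transforms and of measures can be summed without integrability
  conditions. Finiteness of the measure is implied: at \<open>u = 0\<close> the integral is the total mass, and it equals
  the real number \<open>f 0\<close>.
\<close>

definition laplace_of :: "'a measure \<Rightarrow> ('a \<Rightarrow> real) \<Rightarrow> bool"
  where "laplace_of N f \<longleftrightarrow> sets N = sets borel \<and> (AE x in N. x \<in> C) \<and>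
    (\<forall>u\<in>C. 0 \<le> f u \<and> (\<integral>\<^sup>+x. ennreal (exp (- (u \<bullet> x))) \<partial>N) = ennreal (f u))"

definition is_laplace :: "('a \<Rightarrow> real) \<Rightarrow> bool"
  where "is_laplace f \<longleftrightarrow> (\<exists>N. laplace_of N f)"

lemma laplace_of_emeasure_space:
  assumes "laplace_of N f"
  shows "emeasure N (space N) = ennreal (f 0)"
  using assms zero_in_C unfolding laplace_of_def by auto

lemma laplace_of_finite_measure:
  assumes "laplace_of N f"
  shows "finite_measure N"
  by (rule finite_measureI) (simp add: laplace_of_emeasure_space[OF assms])

lemma laplace_of_integral:
  assumes "laplace_of N f" "u \<in> C"
  shows "integrable N (\<lambda>x. exp (- (u \<bullet> x)))" and "(\<integral>x. exp (- (u \<bullet> x)) \<partial>N) = f u"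
proof -
  have [measurable_cong]: "sets N = sets borel"
    using assms by (simp add: laplace_of_def)
  have "(\<lambda>x. exp (- (u \<bullet> x))) \<in> borel_measurable N"
    by simp
  then show "integrable N (\<lambda>x. exp (- (u \<bullet> x)))" "(\<integral>x. exp (- (u \<bullet> x)) \<partial>N) = f u"
    using assms nn_integral_eq_integrable[of "\<lambda>x. exp (- (u \<bullet> x))" N "f u"]
    unfolding laplace_of_def by auto
qed

lemma laplace_of_prob_space:
  assumes "laplace_of N f" "f 0 = 1"
  shows "prob_space N"
  by (rule prob_spaceI) (simp add: laplace_of_emeasure_space[OF assms(1)] assms(2))

lemma is_laplace_nonneg: "is_laplace f \<Longrightarrow> u \<in> C \<Longrightarrow> 0 \<le> f u"
  by (auto simp: is_laplace_def laplace_of_def)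

lemma is_laplace_cong:
  assumes "is_laplace f" "\<And>u. u \<in> C \<Longrightarrow> f u = g u"
  shows "is_laplace g"
  using assms unfolding is_laplace_def laplace_of_def by metis

lemma is_laplace_exp:
  assumes "y \<in> C"
  shows "is_laplace (\<lambda>u. exp (- (u \<bullet> y)))"
proof -
  have "laplace_of (return borel y) (\<lambda>u. exp (- (u \<bullet> y)))"
    unfolding laplace_of_def using assms
    by (simp add: nn_integral_return AE_return)
  then show ?thesis
    unfolding is_laplace_def by blast
qed

lemma is_laplace_cmult:
  assumes "is_laplace f" "0 \<le> a"
  shows "is_laplace (\<lambda>u. a * f u)"
proof -
  obtain N where N: "laplace_of N f"
    using assms unfolding is_laplace_def by blast
  then have [measurable_cong]: "sets N = sets borel"
    by (simp add: laplace_of_def)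
  have "laplace_of (density N (\<lambda>_. ennreal a)) (\<lambda>u. a * f u)"
    using N assms(2) unfolding laplace_of_def
    by (auto simp: AE_density nn_integral_density nn_integral_cmult ennreal_mult)
  then show ?thesis
    unfolding is_laplace_def by blast
qed

lemma is_laplace_one: "is_laplace (\<lambda>_. 1)"
  using is_laplace_exp[OF zero_in_C] by simp

text \<open>
  The sum of independent variables: the witness is the convolution of the two measures.
\<close>

lemma is_laplace_mult:
  assumes "is_laplace f" "is_laplace g"
  shows "is_laplace (\<lambda>u. f u * g u)"
proof -
  obtain N M where N: "laplace_of N f" and M: "laplace_of M g"
    using assms unfolding is_laplace_def by blast
  interpret N: finite_measure N by (rule laplace_of_finite_measure[OF N])
  interpret M: finite_measure M by (rule laplace_of_finite_measure[OF M])
  interpret NM: pair_sigma_finite N M ..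
  have sets [measurable_cong]: "sets N = sets borel" "sets M = sets borel"
    using N M by (simp_all add: laplace_of_def)
  let ?P = "distr (N \<Otimes>\<^sub>M M) borel (\<lambda>(x, y). x + y)"
  have "AE z in ?P. z \<in> C"
  proof -
    have "AE x in N. AE y in M. x + y \<in> C"
    proof -
      have "AE x in N. x \<in> C" and C: "AE y in M. y \<in> C"
        using N M by (simp_all add: laplace_of_def)
      from this(1) show ?thesis
        by eventually_elim (use C in eventually_elim, simp add: add_in_C)
    qed
    then have "AE p in N \<Otimes>\<^sub>M M. (case p of (x, y) \<Rightarrow> x + y) \<in> C"
      by (intro NM.AE_pair_measure) (auto simp: split_beta)
    then show ?thesis
      by (subst AE_distr_iff) auto
  qed
  moreover have "(\<integral>\<^sup>+z. ennreal (exp (- (u \<bullet> z))) \<partial>?P) = ennreal (f u * g u)" if u: "u \<in> C" for u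
  proof -
    have "(\<integral>\<^sup>+z. ennreal (exp (- (u \<bullet> z))) \<partial>?P)
        = (\<integral>\<^sup>+p. ennreal (exp (- (u \<bullet> (fst p + snd p)))) \<partial>(N \<Otimes>\<^sub>M M))"
      by (subst nn_integral_distr) (auto simp: split_beta)
    also have "\<dots> = (\<integral>\<^sup>+x. \<integral>\<^sup>+y. ennreal (exp (- (u \<bullet> x))) * ennreal (exp (- (u \<bullet> y))) \<partial>M \<partial>N)"
      by (subst M.nn_integral_fst[symmetric])
         (auto simp: inner_add_right exp_add[symmetric] ennreal_mult[symmetric])
    also have "\<dots> = ennreal (f u * g u)"
      using N M u unfolding laplace_of_def
      by (simp add: nn_integral_cmult nn_integral_multc ennreal_mult)
    finally show ?thesis .
  qed
  ultimately have "laplace_of ?P (\<lambda>u. f u * g u)"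
    using N M unfolding laplace_of_def by simp
  then show ?thesis
    unfolding is_laplace_def by blast
qed

lemma is_laplace_power:
  assumes "is_laplace f"
  shows "is_laplace (\<lambda>u. f u ^ m)"
  by (induction m) (simp_all add: is_laplace_one is_laplace_mult assms)

lemma is_laplace_sums:
  assumes f: "\<And>m. is_laplace (f m)" and g: "\<And>u. u \<in> C \<Longrightarrow> (\<lambda>m. f m u) sums g u"
  shows "is_laplace g"
proof -
  obtain N where N: "\<And>m. laplace_of (N m) (f m)"
    using f unfolding is_laplace_def by metis
  then have sets_N: "sets (N m) = sets borel" for m
    by (simp add: laplace_of_def)
  obtain S where S: "sets S = sets borel"
    "\<And>h. h \<in> borel_measurable borel \<Longrightarrow> (\<integral>\<^sup>+x. h x \<partial>S) = (\<Sum>m. \<integral>\<^sup>+x. h x \<partial>N m)"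
    using countable_sum_of_measures[of N, OF sets_N] by metis
  have "(\<integral>\<^sup>+x. indicator (- C) x \<partial>N m) = 0" for m
    using N[of m] sets_N[of m] unfolding laplace_of_def
    by (subst nn_integral_0_iff_AE) (auto simp: indicator_eq_0_iff)
  then have "(\<integral>\<^sup>+x. indicator (- C) x \<partial>S) = 0"
    by (simp add: S(2))
  then have "AE x in S. x \<in> C"
    using S(1) by (subst (asm) nn_integral_0_iff_AE) (auto simp: indicator_eq_0_iff)
  moreover have "0 \<le> g u \<and> (\<integral>\<^sup>+x. ennreal (exp (- (u \<bullet> x))) \<partial>S) = ennreal (g u)" if u: "u \<in> C" for u
  proof -
    have nonneg: "0 \<le> f m u" for m
      using is_laplace_nonneg[OF f u] .
    have "(\<integral>\<^sup>+x. ennreal (exp (- (u \<bullet> x))) \<partial>S) = (\<Sum>m. ennreal (f m u))"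
      using N u by (subst S(2)) (auto simp: laplace_of_def)
    also have "\<dots> = ennreal (g u)"
      using g[OF u] nonneg by (simp add: suminf_ennreal2 sums_iff)
    finally show ?thesis
      using sums_le[OF nonneg sums_zero g[OF u]] by simp
  qed
  ultimately show ?thesis
    using S(1) unfolding is_laplace_def laplace_of_def by blast
qed

text \<open>
  This is randomisation: for a probability distribution \<open>a\<close> on the natural numbers the witness is the
  law of the sum of a random number of independent copies. It is used below for the Sibuya
  distribution and for the Poisson distribution.
\<close>

lemma is_laplace_power_series:
  assumes "is_laplace f" and "\<And>m. 0 \<le> a m" and "\<And>u. u \<in> C \<Longrightarrow> (\<lambda>m. a m * f u ^ m) sums g u"
  shows "is_laplace g"
proof (rule is_laplace_sums)
  show "is_laplace (\<lambda>u. a m * f u ^ m)" for m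
    using assms by (intro is_laplace_cmult is_laplace_power)
qed (fact assms(3))

lemma is_laplace_zero: "is_laplace (\<lambda>_. 0)"
  using is_laplace_cmult[OF is_laplace_one, of 0] by simp

lemma is_laplace_add:
  assumes "is_laplace f" "is_laplace g"
  shows "is_laplace (\<lambda>u. f u + g u)"
proof (rule is_laplace_sums)
  show "is_laplace (\<lambda>u. if m = 0 then f u else if m = 1 then g u else 0)" for m :: nat
    using assms is_laplace_zero by (cases "m = 0"; cases "m = 1") simp_all
  show "(\<lambda>m. if m = 0 then f u else if m = 1 then g u else 0) sums (f u + g u)" for u
    using sums_finite[of "{0, 1}" "\<lambda>m::nat. if m = 0 then f u else if m = 1 then g u else 0"]
    by simp
qed

lemma is_laplace_sum:
  assumes "finite I" "\<And>i. i \<in> I \<Longrightarrow> is_laplace (f i)"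
  shows "is_laplace (\<lambda>u. \<Sum>i\<in>I. f i u)"
  using assms by (induction I rule: finite_induct) (simp_all add: is_laplace_zero is_laplace_add)

text \<open>
  Up to the factor \<open>1 / c\<close> this is the Laplace transform of \<open>E *\<^sub>R r\<close>, where \<open>E\<close> is exponentially
  distributed with rate \<open>c\<close>. Multiplying the density of \<open>E\<close> by an exponential gives, up to a constant,
  the exponential density whose rate is larger by \<open>u \<bullet> r\<close>, so no integral has to be evaluated.
\<close>

lemma is_laplace_inverse_affine:
  assumes c: "0 < c" and ray: "\<And>s. 0 \<le> s \<Longrightarrow> s *\<^sub>R r \<in> C" and pos: "\<And>u. u \<in> C \<Longrightarrow> 0 \<le> u \<bullet> r"
  shows "is_laplace (\<lambda>u. 1 / (c + u \<bullet> r))"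
proof -
  let ?E = "density lborel (\<lambda>s. ennreal (exponential_density c s))"
  let ?N = "distr ?E borel (\<lambda>s. s *\<^sub>R r)"
  have "AE s in ?E. 0 \<le> s"
    by (subst AE_density) (auto simp: exponential_density_def)
  then have "AE s in ?E. s *\<^sub>R r \<in> C"
    by eventually_elim (rule ray)
  then have "AE x in ?N. x \<in> C"
    by (subst AE_distr_iff) auto
  moreover have "(\<integral>\<^sup>+x. ennreal (exp (- (u \<bullet> x))) \<partial>?N) = ennreal (c / (c + u \<bullet> r))" if u: "u \<in> C" for u
  proof -
    have "0 < c + u \<bullet> r"
      using c pos[OF u] by simp
    have tilt: "exponential_density c s * exp (- (s * (u \<bullet> r)))
        = c / (c + u \<bullet> r) * exponential_density (c + u \<bullet> r) s" for s
    proof -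
      have "exp (- s * c) * exp (- (s * (u \<bullet> r))) = exp (- s * (c + u \<bullet> r))"
        by (simp add: exp_add[symmetric] algebra_simps)
      then show ?thesis
        using \<open>0 < c + u \<bullet> r\<close> by (simp add: exponential_density_def)
    qed
    interpret prob_space "density lborel (\<lambda>s. ennreal (exponential_density (c + u \<bullet> r) s))"
      by (rule prob_space_exponential_density) fact
    have "(\<integral>\<^sup>+x. ennreal (exp (- (u \<bullet> x))) \<partial>?N)
        = (\<integral>\<^sup>+s. ennreal (exponential_density c s * exp (- (s * (u \<bullet> r)))) \<partial>lborel)"
      using c by (simp add: nn_integral_distr nn_integral_density ennreal_mult exponential_density_nonneg)
    also have "\<dots> = (\<integral>\<^sup>+s. ennreal (c / (c + u \<bullet> r)) * ennreal (exponential_density (c + u \<bullet> r) s) \<partial>lborel)"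
      using c \<open>0 < c + u \<bullet> r\<close> by (simp only: tilt, simp add: ennreal_mult[symmetric] exponential_density_nonneg)
    also have "\<dots> = ennreal (c / (c + u \<bullet> r))"
      using emeasure_space_1 by (simp add: nn_integral_cmult emeasure_density)
    finally show ?thesis .
  qed
  ultimately have "laplace_of ?N (\<lambda>u. c / (c + u \<bullet> r))"
    using c pos unfolding laplace_of_def by (simp add: add_nonneg_nonneg)
  then have "is_laplace (\<lambda>u. 1 / c * (c / (c + u \<bullet> r)))"
    using c by (intro is_laplace_cmult) (auto simp: is_laplace_def)
  then show ?thesis
    using c by simp
qed

end

section \<open>The resolvent of a sub-intensity matrix by uniformization\<close>

text \<open>
  Uniformization makes the jump process stay an exponential time of the same rate \<open>c\<close> in every state,
  at the price of jumps from a state to itself; \<open>c\<close> must dominate all the rates \<open>- T $ i $ i\<close>. All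
  matrices that occur are then nonnegative, and the resolvent applied to the exit vector becomes a
  series of nonnegative terms.
\<close>

locale uniformized_sub_intensity =
  fixes T :: "real ^ 'p ^ 'p" and c :: real
  assumes sub_intensity: "sub_intensity_matrix T"
    and c_pos: "0 < c" and c_bound: "\<And>i. - T $ i $ i \<le> c"
begin

text \<open>
  The entries of \<open>c I + T\<close>: the rates of the jumps, self-jumps included, of the uniformized process.
\<close>

definition jump_rate :: "'p \<Rightarrow> 'p \<Rightarrow> real"
  where "jump_rate i j = (if i = j then c else 0) + T $ i $ j"

lemma jump_rate_nonneg: "0 \<le> jump_rate i j"
  using sub_intensity c_bound[of i] unfolding jump_rate_def sub_intensity_matrix_def by auto

lemma exit_vector_nth: "exit_vector T $ i = - (\<Sum>j\<in>UNIV. T $ i $ j)"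
  by (simp add: exit_vector_def matrix_vector_mult_def)

lemma exit_vector_nonneg: "0 \<le> exit_vector T $ i"
  using sub_intensity by (simp add: exit_vector_nth sub_intensity_matrix_def)

lemma sum_jump_rate_mult: "(\<Sum>j\<in>UNIV. jump_rate i j * y j) = c * y i + (\<Sum>j\<in>UNIV. T $ i $ j * y j)"
proof -
  have "jump_rate i j * y j = (if i = j then c * y i else 0) + T $ i $ j * y j" for j
    by (simp add: jump_rate_def algebra_simps)
  then show ?thesis
    by (simp add: sum.distrib)
qed

lemma exit_plus_jump_rates: "exit_vector T $ i + (\<Sum>j\<in>UNIV. jump_rate i j) = c"
  using sum_jump_rate_mult[of i "\<lambda>_. 1"] by (simp add: exit_vector_nth)

text \<open>
  The first-step form of the resolvent equation. With \<open>b = exit_vector T\<close>, iterating it produces the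
  series of the \<open>absorption_term\<close>s below.
\<close>

lemma resolvent_equation_iff:
  "(diag_matrix v - T) *v y = b \<longleftrightarrow>
    (\<forall>i. (c + v $ i) * y $ i = b $ i + (\<Sum>j\<in>UNIV. jump_rate i j * y $ j))"
proof -
  have "((diag_matrix v - T) *v y) $ i = v $ i * y $ i - (\<Sum>j\<in>UNIV. T $ i $ j * y $ j)" for i
  proof -
    have "(if i = j then v $ i else 0) * y $ j = (if i = j then v $ i * y $ i else 0)" for j
      by simp
    then show ?thesis
      unfolding matrix_vector_mult_diff_rdistrib
      by (simp add: matrix_vector_mult_def diag_matrix_def)
  qed
  moreover have "x * y - s = d \<longleftrightarrow> (c + x) * y = d + (c * y + s)" for x y s d :: real
    by (auto simp: distrib_right)
  ultimately show ?thesis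
    unfolding vec_eq_iff sum_jump_rate_mult by simp
qed

text \<open>
  For \<open>v \<ge> 0\<close>, let the uniformized process be killed at rate \<open>v $ i\<close> while it is in state \<open>i\<close>. The value is the
  probability that, started in \<open>i\<close>, it makes exactly \<open>m\<close> jumps among the transient states and is
  then absorbed before being killed.
\<close>

primrec absorption_term :: "real ^ 'p \<Rightarrow> nat \<Rightarrow> 'p \<Rightarrow> real"
  where
    "absorption_term v 0 i = 1 / (c + v $ i) * exit_vector T $ i"
  | "absorption_term v (Suc m) i = 1 / (c + v $ i) * (\<Sum>j\<in>UNIV. jump_rate i j * absorption_term v m j)"

definition absorption_partial :: "real ^ 'p \<Rightarrow> nat \<Rightarrow> 'p \<Rightarrow> real"
  where "absorption_partial v m i = (\<Sum>l<m. absorption_term v l i)"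

definition absorption :: "real ^ 'p \<Rightarrow> 'p \<Rightarrow> real"
  where "absorption v i = (\<Sum>m. absorption_term v m i)"

lemma absorption_partial_0: "absorption_partial v 0 i = 0"
  by (simp add: absorption_partial_def)

lemma absorption_partial_Suc:
  "absorption_partial v (Suc m) i
    = 1 / (c + v $ i) * (exit_vector T $ i + (\<Sum>j\<in>UNIV. jump_rate i j * absorption_partial v m j))"
proof -
  have "(\<Sum>l<m. absorption_term v (Suc l) i) = 1 / (c + v $ i) * (\<Sum>j\<in>UNIV. jump_rate i j * absorption_partial v m j)"
    unfolding absorption_partial_def absorption_term.simps sum_distrib_left
    by (rule sum.swap)
  then show ?thesis
    unfolding absorption_partial_def sum.lessThan_Suc_shift by (simp add: distrib_left)
qed

context
  fixes v :: "real ^ 'p"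
  assumes v_nonneg: "\<And>i. 0 \<le> v $ i"
begin

lemma denominator_pos: "0 < c + v $ i"
  using c_pos v_nonneg[of i] by simp

lemma absorption_term_nonneg: "0 \<le> absorption_term v m i"
  using denominator_pos
  by (induction m arbitrary: i)
     (auto simp: exit_vector_nonneg jump_rate_nonneg less_imp_le intro!: divide_nonneg_pos sum_nonneg mult_nonneg_nonneg)

text \<open>
  The probabilistic meaning predicts this bound. Analytically, the constant vector 1 is a
  supersolution of the recursion for the partial sums, because the exit rate and the jump rates of
  any state add up to \<open>c\<close>.
\<close>

lemma absorption_partial_le_1: "absorption_partial v m i \<le> 1"
proof (induction m arbitrary: i)
  case (Suc m)
  have "(\<Sum>j\<in>UNIV. jump_rate i j * absorption_partial v m j) \<le> (\<Sum>j\<in>UNIV. jump_rate i j * 1)"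
    using Suc jump_rate_nonneg by (intro sum_mono mult_left_mono) auto
  then have "exit_vector T $ i + (\<Sum>j\<in>UNIV. jump_rate i j * absorption_partial v m j) \<le> c + v $ i"
    using exit_plus_jump_rates[of i] v_nonneg[of i] by simp
  then show ?case
    using denominator_pos[of i] by (simp add: absorption_partial_Suc)
qed (simp add: absorption_partial_0)

lemma absorption_term_sums: "(\<lambda>m. absorption_term v m i) sums absorption v i"
proof -
  have "summable (\<lambda>m. absorption_term v m i)"
  proof (rule bounded_imp_summable)
    show "(\<Sum>l\<le>m. absorption_term v l i) \<le> 1" for m
      using absorption_partial_le_1[of "Suc m" i] by (simp add: absorption_partial_def lessThan_Suc_atMost)
  qed (rule absorption_term_nonneg)
  then show ?thesis
    unfolding absorption_def by (rule summable_sums)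
qed

lemma absorption_partial_tendsto: "(\<lambda>m. absorption_partial v m i) \<longlonglongrightarrow> absorption v i"
  using absorption_term_sums[of i] by (simp add: sums_def absorption_partial_def)

lemma absorption_solves_resolvent_equation:
  "(diag_matrix v - T) *v (\<chi> i. absorption v i) = exit_vector T"
proof -
  have "absorption v i = 1 / (c + v $ i) * (exit_vector T $ i + (\<Sum>j\<in>UNIV. jump_rate i j * absorption v j))" for i
  proof (rule LIMSEQ_unique)
    show "(\<lambda>m. absorption_partial v (Suc m) i) \<longlonglongrightarrow> absorption v i"
      by (rule LIMSEQ_Suc) (rule absorption_partial_tendsto)
    show "(\<lambda>m. absorption_partial v (Suc m) i)
        \<longlonglongrightarrow> 1 / (c + v $ i) * (exit_vector T $ i + (\<Sum>j\<in>UNIV. jump_rate i j * absorption v j))"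
      unfolding absorption_partial_Suc
      by (intro tendsto_intros absorption_partial_tendsto)
  qed
  then show ?thesis
    using denominator_pos less_imp_neq[OF denominator_pos]
    by (subst resolvent_equation_iff) (simp add: field_simps)
qed

end

text \<open>
  Without killing, absorption is certain. This is where the invertibility of \<open>T\<close> enters: the constant
  vector 1 solves the same linear system as the vector of absorption probabilities.
\<close>

lemma absorption_at_0: "absorption 0 i = 1"
proof -
  have "T *v (\<chi> i. absorption 0 i) = T *v (\<chi> i. 1)"
  proof -
    have "diag_matrix 0 = (0 :: real ^ 'p ^ 'p)"
      by (simp add: diag_matrix_def vec_eq_iff)
    then show ?thesis
      using absorption_solves_resolvent_equation[of 0]
      unfolding exit_vector_def matrix_vector_mult_diff_rdistrib by simp
  qed
  moreover have "inj ((*v) T)"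
    using sub_intensity invertible_left_inverse matrix_left_invertible_injective
    unfolding sub_intensity_matrix_def by blast
  ultimately have "(\<chi> i. absorption 0 i) = (\<chi> i. 1)"
    by (simp add: inj_eq)
  then show ?thesis
    by (simp add: vec_eq_iff)
qed

text \<open>
  A vector \<open>y\<close> in the kernel satisfies \<open>c \<bar>y $ i\<bar> \<le> (\<Sum>j\<in>UNIV. jump_rate i j * \<bar>y $ j\<bar>)\<close>. Iterated from
  \<open>\<bar>y $ i\<bar> \<le> K\<close>, this bounds \<open>\<bar>y $ i\<bar>\<close> by \<open>K\<close> times the probability that the process without killing
  makes at least \<open>m\<close> jumps among the transient states, started in \<open>i\<close>. That probability vanishes
  in the limit since absorption is certain.
\<close>

lemma resolvent_invertible:
  assumes v_nonneg: "\<And>i. 0 \<le> v $ i"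
  shows "invertible (diag_matrix v - T)"
proof -
  have "y = 0" if "(diag_matrix v - T) *v y = 0" for y
  proof -
    have y: "(c + v $ i) * y $ i = (\<Sum>j\<in>UNIV. jump_rate i j * y $ j)" for i
      using that resolvent_equation_iff[of v y 0] by simp
    obtain K where K: "\<And>i. \<bar>y $ i\<bar> \<le> K"
      using component_le_norm_cart by blast
    have bound: "\<bar>y $ i\<bar> \<le> K * (1 - absorption_partial 0 m i)" for m i
    proof (induction m arbitrary: i)
      case 0
      show ?case
        using K by (simp add: absorption_partial_0)
    next
      case (Suc m)
      have "c * \<bar>y $ i\<bar> \<le> (c + v $ i) * \<bar>y $ i\<bar>"
        using v_nonneg by (intro mult_right_mono) auto
      also have "\<dots> = \<bar>\<Sum>j\<in>UNIV. jump_rate i j * y $ j\<bar>"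
        using c_pos v_nonneg[of i] by (simp add: y[symmetric] abs_mult)
      also have "\<dots> \<le> (\<Sum>j\<in>UNIV. jump_rate i j * \<bar>y $ j\<bar>)"
        using jump_rate_nonneg by (intro order_trans[OF sum_abs]) (simp add: abs_mult)
      also have "\<dots> \<le> (\<Sum>j\<in>UNIV. jump_rate i j * (K * (1 - absorption_partial 0 m j)))"
        using Suc jump_rate_nonneg by (intro sum_mono mult_left_mono) auto
      also have "\<dots> = K * ((\<Sum>j\<in>UNIV. jump_rate i j) - (\<Sum>j\<in>UNIV. jump_rate i j * absorption_partial 0 m j))"
        by (simp add: right_diff_distrib sum_subtractf sum_distrib_left mult_ac)
      also have "\<dots> = K * (c - c * absorption_partial 0 (Suc m) i)"
      proof -
        have "(\<Sum>j\<in>UNIV. jump_rate i j) - (\<Sum>j\<in>UNIV. jump_rate i j * absorption_partial 0 m j)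
            = c - c * absorption_partial 0 (Suc m) i"
          using c_pos exit_plus_jump_rates[of i] by (simp add: absorption_partial_Suc)
        then show ?thesis
          by (simp only:)
      qed
      finally have "c * \<bar>y $ i\<bar> \<le> c * (K * (1 - absorption_partial 0 (Suc m) i))"
        by (simp add: algebra_simps)
      then show ?case
        using c_pos by simp
    qed
    have "(\<lambda>m. K * (1 - absorption_partial 0 m i)) \<longlonglongrightarrow> K * (1 - 1)" for i
      using absorption_partial_tendsto[of 0 i]
      by (intro tendsto_intros) (simp add: absorption_at_0)
    then have "\<bar>y $ i\<bar> \<le> K * (1 - 1)" for i
      by (rule LIMSEQ_le_const) (use bound in blast)
    then show "y = 0"
      by (simp add: vec_eq_iff)
  qed
  then show ?thesis
    by (simp add: invertible_left_inverse matrix_left_invertible_ker)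
qed

lemma resolvent_exit_vector:
  assumes v_nonneg: "\<And>i. 0 \<le> v $ i"
  shows "matrix_inv (diag_matrix v - T) *v exit_vector T = (\<chi> i. absorption v i)"
proof -
  have "matrix_inv (diag_matrix v - T) ** (diag_matrix v - T) = mat 1"
    using someI_ex[OF resolvent_invertible[OF assms, unfolded invertible_def]]
    unfolding matrix_inv_def by blast
  then have "matrix_inv (diag_matrix v - T) *v ((diag_matrix v - T) *v (\<chi> i. absorption v i)) = (\<chi> i. absorption v i)"
    by (simp add: matrix_vector_mul_assoc)
  then show ?thesis
    by (simp add: absorption_solves_resolvent_equation assms)
qed

end

section \<open>The Laplace transform of an MPH* distribution\<close>

interpretation orthant: laplace_domain "nonneg_orthant :: (real ^ 'n) set"
proof
  have "(nonneg_orthant :: (real ^ 'n) set) = (\<Inter>k. {u. 0 \<le> u $ k})"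
    by (auto simp: nonneg_orthant_def)
  moreover have "closed \<dots>"
    by (intro closed_INT ballI closed_Collect_le continuous_intros)
  ultimately show "(nonneg_orthant :: (real ^ 'n) set) \<in> sets borel"
    by (simp add: borel_closed)
qed (simp_all add: nonneg_orthant_def)

lemma matrix_vector_nonneg:
  fixes R :: "real ^ 'n ^ 'p"
  assumes "\<And>i k. 0 \<le> R $ i $ k" "u \<in> nonneg_orthant"
  shows "0 \<le> (R *v u) $ i"
  using assms by (simp add: matrix_vector_mult_def nonneg_orthant_def sum_nonneg)

text \<open>
  Each term of the series is built by sums and products from nonnegative constants and the factors
  \<open>1 / (c + (R *v u) $ i)\<close>, that is, from the transforms of the rewards collected during one holding
  time in state \<open>i\<close>.
\<close>

lemma (in uniformized_sub_intensity) is_laplace_absorption: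
  fixes R :: "real ^ 'n ^ 'p"
  assumes R: "\<And>i k. 0 \<le> R $ i $ k"
  shows "orthant.is_laplace (\<lambda>u. absorption (R *v u) i)"
proof (rule orthant.is_laplace_sums)
  fix u :: "real ^ 'n" assume "u \<in> nonneg_orthant"
  then show "(\<lambda>m. absorption_term (R *v u) m i) sums absorption (R *v u) i"
    by (intro absorption_term_sums matrix_vector_nonneg R)
next
  have holding: "orthant.is_laplace (\<lambda>u. 1 / (c + (R *v u) $ i))" for i
  proof -
    have "(R *v u) $ i = u \<bullet> R $ i" for u :: "real ^ 'n"
      by (simp add: matrix_vector_mult_def inner_vec_def mult.commute)
    moreover have "s *\<^sub>R R $ i \<in> nonneg_orthant" if "0 \<le> s" for s
      using R that by (simp add: nonneg_orthant_def)
    moreover have "0 \<le> u \<bullet> R $ i" if "u \<in> nonneg_orthant" for u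
      using R that by (simp add: nonneg_orthant_def inner_vec_def sum_nonneg)
    ultimately show ?thesis
      using orthant.is_laplace_inverse_affine[OF c_pos, of "R $ i"] by simp
  qed
  show "orthant.is_laplace (\<lambda>u. absorption_term (R *v u) m i)" for m
  proof (induction m arbitrary: i)
    case 0
    show ?case
      using orthant.is_laplace_cmult[OF holding exit_vector_nonneg, of i i]
      by (simp add: mult.commute)
  next
    case (Suc m)
    have "orthant.is_laplace (\<lambda>u. \<Sum>j\<in>UNIV. jump_rate i j * absorption_term (R *v u) m j)"
      by (rule orthant.is_laplace_sum) (simp_all add: orthant.is_laplace_cmult Suc jump_rate_nonneg)
    from orthant.is_laplace_mult[OF holding this] show ?case
      by simp
  qed
qed

lemma is_laplace_MPH_star:
  fixes R :: "real ^ 'n ^ 'p"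
  assumes "MPH_star_representation \<pi> T R"
  shows "orthant.is_laplace (\<lambda>u. (\<pi> v* matrix_inv (diag_matrix (R *v u) - T)) \<bullet> exit_vector T)"
    and "(\<pi> v* matrix_inv (diag_matrix (R *v 0) - T)) \<bullet> exit_vector T = 1"
proof -
  have T: "sub_intensity_matrix T" and R: "\<And>i k. 0 \<le> R $ i $ k"
    and \<pi>: "\<And>i. 0 \<le> \<pi> $ i" "(\<Sum>i\<in>UNIV. \<pi> $ i) = 1"
    using assms unfolding MPH_star_representation_def phase_type_representation_def prob_vector_def by auto
  \<comment> \<open>any \<open>c > 0\<close> that dominates the numbers \<open>- T $ i $ i\<close> would do\<close>
  define c where "c = 1 + (\<Sum>i\<in>UNIV. \<bar>T $ i $ i\<bar>)"
  interpret uniformized_sub_intensity T c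
  proof
    show "0 < c"
      unfolding c_def by (intro add_pos_nonneg sum_nonneg) auto
    show "- T $ i $ i \<le> c" for i
      using member_le_sum[of i UNIV "\<lambda>i. \<bar>T $ i $ i\<bar>"] by (auto simp: c_def)
  qed fact
  have eq: "(\<pi> v* matrix_inv (diag_matrix (R *v u) - T)) \<bullet> exit_vector T
      = (\<Sum>i\<in>UNIV. \<pi> $ i * absorption (R *v u) i)" if "u \<in> nonneg_orthant" for u
    using resolvent_exit_vector[OF matrix_vector_nonneg[OF R that]]
    unfolding dot_lmul_matrix by (simp add: inner_vec_def)
  have "orthant.is_laplace (\<lambda>u. \<Sum>i\<in>UNIV. \<pi> $ i * absorption (R *v u) i)"
    by (rule orthant.is_laplace_sum) (simp_all add: orthant.is_laplace_cmult is_laplace_absorption R \<pi>)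
  then show "orthant.is_laplace (\<lambda>u. (\<pi> v* matrix_inv (diag_matrix (R *v u) - T)) \<bullet> exit_vector T)"
    by (rule orthant.is_laplace_cong) (simp add: eq)
  show "(\<pi> v* matrix_inv (diag_matrix (R *v 0) - T)) \<bullet> exit_vector T = 1"
    by (simp only: eq[OF orthant.zero_in_C]) (simp add: absorption_at_0 \<pi>)
qed

section \<open>The continuity theorem for Laplace transforms on the half-line\<close>

interpretation halfline: laplace_domain "{0..} :: real set"
  by standard auto

text \<open>
  For \<open>x \<ge> 0\<close>, \<open>exp (- (u * x))\<close> is at most \<open>1\<close>, and at most \<open>1 / 2\<close> once \<open>x > 1 / u\<close>. Hence a
  transform that is close to \<open>1\<close> at some \<open>u > 0\<close> leaves little mass beyond \<open>1 / u\<close>. The lower end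
  point of the interval is \<open>-1\<close> because the notion of tightness used below has half-open intervals
  and mass at \<open>0\<close> must be counted.
\<close>

lemma halfline_laplace_tail:
  assumes N: "halfline.laplace_of N f" and f0: "f 0 = 1" and u: "0 < u"
  shows "2 * f u - 1 \<le> measure N {-1<..1 / u}"
proof -
  interpret prob_space N
    by (rule halfline.laplace_of_prob_space[OF N f0])
  have [measurable_cong]: "sets N = sets borel"
    using N by (simp add: halfline.laplace_of_def)
  have "AE x in N. exp (- (u * x)) \<le> 1 / 2 + 1 / 2 * indicator {-1<..1 / u} x"
  proof -
    have "AE x in N. 0 \<le> x"
      using N by (simp add: halfline.laplace_of_def)
    then show ?thesis
    proof eventually_elim
      case (elim x)
      show ?case
      proof (cases "x \<le> 1 / u")
        case True
        then show ?thesis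
          using elim u by (simp add: mult_nonneg_nonneg)
      next
        case False
        then have "1 \<le> u * x"
          using u by (simp add: field_simps)
        then have "2 \<le> exp (u * x)"
          using exp_ge_add_one_self[of "u * x"] by linarith
        then have "exp (- (u * x)) \<le> 1 / 2"
          by (simp add: exp_minus field_simps)
        then show ?thesis
          by (simp add: add_increasing2)
      qed
    qed
  qed
  then have "(\<integral>x. exp (- (u \<bullet> x)) \<partial>N) \<le> (\<integral>x. 1 / 2 + 1 / 2 * indicator {-1<..1 / u} x \<partial>N)"
    using halfline.laplace_of_integral(1)[OF N, of u] u
    by (intro integral_mono_AE) (auto intro!: integrable_const_bound[where B = 1] simp: indicator_def)
  also have "\<dots> = 1 / 2 + 1 / 2 * measure N {-1<..1 / u}"
  proof -
    have "integrable N (\<lambda>x. indicator {-1<..1 / u} x :: real)"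
      by (rule integrable_real_indicator) (auto simp: emeasure_eq_measure)
    then show ?thesis
      by (simp add: prob_space)
  qed
  finally show ?thesis
    using halfline.laplace_of_integral(2)[OF N, of u] u by simp
qed

text \<open>
  Equicontinuity at \<open>0\<close> gives tightness, so by Helly's theorem a subsequence of the measures converges
  weakly. The functions \<open>exp (- (u * x))\<close> are unbounded on the real line; replacing \<open>x\<close> by
  \<open>max 0 x\<close> makes them bounded and continuous without changing the integrals along the sequence. The
  image of the weak limit under \<open>max 0\<close> lives on the half-line and has the limits of these integrals as
  its transform.
\<close>

lemma halfline_laplace_continuity:
  fixes f :: "nat \<Rightarrow> real \<Rightarrow> real"
  assumes f: "\<And>n. halfline.is_laplace (f n)" and f0: "\<And>n. f n 0 = 1"
    and equicontinuous: "\<And>\<epsilon>. 0 < \<epsilon> \<Longrightarrow> \<exists>u>0. \<forall>n. 1 - \<epsilon> < f n u"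
    and limit: "\<And>u. 0 \<le> u \<Longrightarrow> (\<lambda>n. f n u) \<longlonglongrightarrow> g u"
  shows "halfline.is_laplace g"
proof -
  obtain N where N: "\<And>n. halfline.laplace_of (N n) (f n)"
    using f unfolding halfline.is_laplace_def by metis
  have sets_N: "sets (N n) = sets borel" for n
    using N by (simp add: halfline.laplace_of_def)
  have distribution_N: "real_distribution (N n)" for n
    using halfline.laplace_of_prob_space[OF N f0] sets_N
    by (simp add: real_distribution_def real_distribution_axioms_def)
  have "tight N"
    unfolding tight_def
  proof (intro conjI allI impI distribution_N)
    fix \<epsilon> :: real assume "0 < \<epsilon>"
    then obtain u where u: "0 < u" "\<And>n. 1 - \<epsilon> / 2 < f n u"
      using equicontinuous[of "\<epsilon> / 2"] by auto
    have "1 - \<epsilon> < measure (N n) {-1<..1 / u}" for n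
      using halfline_laplace_tail[OF N f0 u(1), of n] u(2)[of n] by simp
    moreover have "- 1 < 1 / u"
      using u(1) by (simp add: less_trans[of _ 0])
    ultimately show "\<exists>a b. a < b \<and> (\<forall>n. 1 - \<epsilon> < measure (N n) {a<..b})"
      by blast
  qed
  moreover have "strict_mono (id :: nat \<Rightarrow> nat)"
    by (simp add: strict_mono_def)
  ultimately obtain r M where r: "strict_mono r" and M: "real_distribution M"
    and weak: "weak_conv_m (N \<circ> id \<circ> r) M"
    using tight_imp_convergent_subsubsequence by blast
  interpret M: real_distribution M
    by (rule M)
  have g_nonneg: "0 \<le> g u" if "0 \<le> u" for u
    using halfline.is_laplace_nonneg[OF f] that by (intro LIMSEQ_le_const[OF limit]) auto
  have M_integral: "(\<integral>x. exp (- (u * max 0 x)) \<partial>M) = g u" if u: "0 \<le> u" for u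
  proof (rule LIMSEQ_unique)
    show "(\<lambda>n. \<integral>x. exp (- (u * max 0 x)) \<partial>(N \<circ> id \<circ> r) n) \<longlonglongrightarrow> (\<integral>x. exp (- (u * max 0 x)) \<partial>M)"
      using distribution_N u
      by (intro weak_conv_imp_integral_bdd_continuous_conv[where B = 1] weak M continuous_intros) auto
    have "(\<integral>x. exp (- (u * max 0 x)) \<partial>N n) = f n u" for n
    proof -
      have "AE x in N n. 0 \<le> x"
        using N[of n] by (simp add: halfline.laplace_of_def)
      then have "AE x in N n. exp (- (u * max 0 x)) = exp (- (u * x))"
        by eventually_elim simp
      moreover note [measurable_cong] = sets_N
      ultimately have "(\<integral>x. exp (- (u * max 0 x)) \<partial>N n) = (\<integral>x. exp (- (u * x)) \<partial>N n)"
        by (intro integral_cong_AE) auto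
      then show ?thesis
        using halfline.laplace_of_integral(2)[OF N, of u n] u by simp
    qed
    then show "(\<lambda>n. \<integral>x. exp (- (u * max 0 x)) \<partial>(N \<circ> id \<circ> r) n) \<longlonglongrightarrow> g u"
      using LIMSEQ_subseq_LIMSEQ[OF limit[OF u] r] by (simp add: comp_def)
  qed
  have "(\<integral>\<^sup>+x. ennreal (exp (- (u * max 0 x))) \<partial>M) = ennreal (g u)" if u: "0 \<le> u" for u
  proof (subst nn_integral_eq_integrable)
    have "integrable M (\<lambda>x. exp (- (u * max 0 x)))"
      using u by (intro M.integrable_const_bound[where B = 1]) auto
    then show "integrable M (\<lambda>x. exp (- (u * max 0 x))) \<and> (\<integral>x. exp (- (u * max 0 x)) \<partial>M) = g u"
      using M_integral[OF u] by simp
  qed (use g_nonneg[OF u] in auto)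
  then have "halfline.laplace_of (distr M borel (max 0)) g"
    using g_nonneg unfolding halfline.laplace_of_def
    by (auto simp: AE_distr_iff nn_integral_distr)
  then show ?thesis
    unfolding halfline.is_laplace_def by blast
qed

section \<open>One-sided stable laws\<close>

text \<open>
  The Sibuya distribution has the probability generating function \<open>1 - (1 - z) powr \<alpha>\<close>. It is the
  elementary source of the power \<open>u powr \<alpha>\<close> in the stable law.
\<close>

definition sibuya_weight :: "real \<Rightarrow> nat \<Rightarrow> real"
  where "sibuya_weight \<alpha> k = (if k = 0 then 0 else - ((- 1) ^ k * (\<alpha> gchoose k)))"

lemma alternating_gbinomial_nonneg:
  fixes a :: real
  assumes "a < 0"
  shows "0 \<le> (- 1) ^ m * (a gchoose m)"
proof -
  have "(- 1) ^ m * (a gchoose m) = pochhammer (- a) m / fact m"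
    by (simp add: gbinomial_pochhammer flip: power_mult_distrib mult.assoc)
  then show ?thesis
    using assms pochhammer_nonneg[of "- a" m] by simp
qed

lemma sibuya_weight_nonneg:
  assumes "0 < \<alpha>" "\<alpha> < 1"
  shows "0 \<le> sibuya_weight \<alpha> k"
proof (cases k)
  case (Suc m)
  have "(\<alpha> gchoose Suc m) = \<alpha> / real (Suc m) * (\<alpha> - 1 gchoose m)"
    using gbinomial_absorption'[of "Suc m" \<alpha>] by simp
  then have "sibuya_weight \<alpha> k = \<alpha> / real (Suc m) * ((- 1) ^ m * (\<alpha> - 1 gchoose m))"
    by (simp add: sibuya_weight_def Suc)
  then show ?thesis
    using assms alternating_gbinomial_nonneg[of "\<alpha> - 1" m] by simp
qed (simp add: sibuya_weight_def)

lemma sibuya_weight_sums_less_1: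
  assumes "0 \<le> z" "z < 1"
  shows "(\<lambda>k. sibuya_weight \<alpha> k * z ^ k) sums (1 - (1 - z) powr \<alpha>)"
proof -
  have "(\<lambda>k. (\<alpha> gchoose k) * (- z) ^ k) sums (1 - z) powr \<alpha>"
    using gen_binomial_real[of "- z" \<alpha>] assms by simp
  then have "(\<lambda>k. (if k = 0 then 1 else 0) - (\<alpha> gchoose k) * (- z) ^ k) sums (1 - (1 - z) powr \<alpha>)"
    by (intro sums_diff sums_single) 
  moreover have "(if k = 0 then 1 else 0) - (\<alpha> gchoose k) * (- z) ^ k = sibuya_weight \<alpha> k * z ^ k" for k
    by (simp add: sibuya_weight_def power_minus[of z])
  ultimately show ?thesis
    by simp
qed

text \<open>
  A partial sum of the alternating binomial series has a closed form. The sign of that form gives the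
  bound, and with it the summability at \<open>z = 1\<close>, where the binomial series theorem does not apply.
\<close>

lemma sibuya_weight_partial_sum_le_1:
  assumes "\<alpha> < 1"
  shows "(\<Sum>k\<le>m. sibuya_weight \<alpha> k) \<le> 1"
proof -
  have "sibuya_weight \<alpha> k = (if k = 0 then 1 else 0) - (\<alpha> gchoose k) * (- 1) ^ k" for k
    by (simp add: sibuya_weight_def)
  then have "(\<Sum>k\<le>m. sibuya_weight \<alpha> k) = 1 - (- 1) ^ m * (\<alpha> - 1 gchoose m)"
    by (simp add: sum_subtractf gbinomial_sum_lower_neg)
  then show ?thesis
    using alternating_gbinomial_nonneg[of "\<alpha> - 1" m] assms by simp
qed

text \<open>
  The case \<open>z = 1\<close> says that the weights have total mass 1. It is needed because it is the transform
  at \<open>u = 0\<close>, and it follows from the case \<open>z < 1\<close> by letting \<open>z\<close> tend to 1 along \<open>1 - 1 / n\<close>.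
\<close>

lemma sibuya_weight_sums:
  assumes \<alpha>: "0 < \<alpha>" "\<alpha> < 1" and z: "0 \<le> z" "z \<le> 1"
  shows "(\<lambda>k. sibuya_weight \<alpha> k * z ^ k) sums (1 - (1 - z) powr \<alpha>)"
proof (cases "z = 1")
  case False
  then show ?thesis
    using z sibuya_weight_sums_less_1 by simp
next
  case True
  have summable: "summable (sibuya_weight \<alpha>)"
    using sibuya_weight_nonneg[OF \<alpha>] sibuya_weight_partial_sum_le_1[OF \<alpha>(2)]
    by (rule bounded_imp_summable)
  have "(\<Sum>k. sibuya_weight \<alpha> k) \<le> 1"
    using sibuya_weight_partial_sum_le_1[OF \<alpha>(2)]
    by (intro LIMSEQ_le_const2[OF summable_LIMSEQ'[OF summable]]) blast
  moreover have "1 \<le> (\<Sum>k. sibuya_weight \<alpha> k)"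
  proof (rule LIMSEQ_le_const2)
    show "(\<lambda>n. 1 - inverse (real (Suc n)) powr \<alpha>) \<longlonglongrightarrow> 1"
      using tendsto_diff[OF tendsto_const tendsto_powr'[OF LIMSEQ_inverse_real_of_nat tendsto_const[of \<alpha>]], of 1] \<alpha>
      by simp
    have "1 - inverse (real (Suc n)) powr \<alpha> \<le> (\<Sum>k. sibuya_weight \<alpha> k)" for n
    proof -
      define y where "y = 1 - inverse (real (Suc n))"
      have y: "0 \<le> y" "y < 1"
        by (simp_all add: y_def field_simps)
      have "sibuya_weight \<alpha> k * y ^ k \<le> sibuya_weight \<alpha> k" for k
        using mult_left_mono[OF power_le_one[of y k] sibuya_weight_nonneg[OF \<alpha>, of k]] y by simp
      from sums_le[OF this sibuya_weight_sums_less_1[OF y] summable_sums[OF summable]]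
      show ?thesis
        by (simp add: y_def)
    qed
    then show "\<exists>m. \<forall>n\<ge>m. 1 - inverse (real (Suc n)) powr \<alpha> \<le> (\<Sum>k. sibuya_weight \<alpha> k)"
      by blast
  qed
  ultimately have "(\<Sum>k. sibuya_weight \<alpha> k) = 1"
    by (rule antisym)
  then show ?thesis
    using summable_sums[OF summable] True by simp
qed

text \<open>
  A compound Poisson law: a Poisson number with mean \<open>real (Suc n) powr \<alpha>\<close> of independent Sibuya
  variables, each divided by \<open>Suc n\<close>. Since \<open>real (Suc n) * (1 - exp (- (u / real (Suc n))))\<close> tends to
  \<open>u\<close> from below, these transforms tend to \<open>exp (- (u powr \<alpha>))\<close> and stay above it.
\<close>

definition stable_approx :: "real \<Rightarrow> nat \<Rightarrow> real \<Rightarrow> real"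
  where "stable_approx \<alpha> n u = exp (- ((real (Suc n) * (1 - exp (- (u / real (Suc n))))) powr \<alpha>))"

lemma is_laplace_stable_approx:
  assumes \<alpha>: "0 < \<alpha>" "\<alpha> < 1"
  shows "halfline.is_laplace (stable_approx \<alpha> n)"
proof -
  define l where "l = real (Suc n) powr \<alpha>"
  define h where "h u = 1 - (1 - exp (- (u / real (Suc n)))) powr \<alpha>" for u
  have "halfline.is_laplace h"
  proof (rule halfline.is_laplace_power_series)
    show "halfline.is_laplace (\<lambda>u. exp (- (u \<bullet> (1 / real (Suc n)))))"
      by (rule halfline.is_laplace_exp) simp
    show "(\<lambda>k. sibuya_weight \<alpha> k * exp (- (u \<bullet> (1 / real (Suc n)))) ^ k) sums h u" if "u \<in> {0..}" for u
      using sibuya_weight_sums[OF \<alpha>, of "exp (- (u / real (Suc n)))"] that by (simp add: h_def)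
  qed (rule sibuya_weight_nonneg[OF \<alpha>])
  then have "halfline.is_laplace (\<lambda>u. exp (l * h u))"
  proof (rule halfline.is_laplace_power_series)
    show "0 \<le> l ^ m / fact m" for m
      by (simp add: l_def)
    show "(\<lambda>m. l ^ m / fact m * h u ^ m) sums exp (l * h u)" for u
      using exp_converges[of "l * h u"] by (simp add: power_mult_distrib divide_inverse mult_ac)
  qed
  then have "halfline.is_laplace (\<lambda>u. exp (- l) * exp (l * h u))"
    by (rule halfline.is_laplace_cmult) simp
  then show ?thesis
  proof (rule halfline.is_laplace_cong)
    fix u :: real assume "u \<in> {0..}"
    then have "(real (Suc n) * (1 - exp (- (u / real (Suc n))))) powr \<alpha> = l * (1 - h u)"
      unfolding l_def h_def by (subst powr_mult) auto
    then show "exp (- l) * exp (l * h u) = stable_approx \<alpha> n u"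
      by (simp add: stable_approx_def algebra_simps flip: exp_add)
  qed
qed

lemma scaled_one_minus_exp_bounds:
  fixes u :: real
  assumes "0 \<le> u"
  shows "u / (1 + u / real (Suc n)) \<le> real (Suc n) * (1 - exp (- (u / real (Suc n))))"
    and "real (Suc n) * (1 - exp (- (u / real (Suc n)))) \<le> u"
proof -
  define x where "x = u / real (Suc n)"
  have x: "0 \<le> x" "u = real (Suc n) * x"
    using assms by (simp_all add: x_def)
  have "exp (- x) \<le> 1 / (1 + x)"
    using exp_ge_add_one_self[of x] x(1) by (simp add: exp_minus divide_inverse le_imp_inverse_le)
  then have "x / (1 + x) \<le> 1 - exp (- x)"
    using x(1) by (simp add: field_simps)
  from mult_left_mono[OF this, of "real (Suc n)"]
  show "u / (1 + u / real (Suc n)) \<le> real (Suc n) * (1 - exp (- (u / real (Suc n))))"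
    by (simp add: x(2))
  show "real (Suc n) * (1 - exp (- (u / real (Suc n)))) \<le> u"
    using mult_left_mono[of "1 - exp (- x)" x "real (Suc n)"] exp_minus_ge[of x] by (simp add: x(2))
qed

text \<open>
  For \<open>\<alpha> = 1\<close> the law is the point mass at \<open>1\<close>. For \<open>\<alpha> < 1\<close> it is the limit of the compound Poisson
  approximations; the limit bounds all of them from below, which is the equicontinuity at \<open>0\<close> that
  the continuity theorem asks for.
\<close>

lemma is_laplace_stable:
  assumes \<alpha>: "0 < \<alpha>" "\<alpha> \<le> 1"
  shows "halfline.is_laplace (\<lambda>u. exp (- (u powr \<alpha>)))"
proof (cases "\<alpha> = 1")
  case True
  have "halfline.is_laplace (\<lambda>u. exp (- (u \<bullet> 1)))"
    by (rule halfline.is_laplace_exp) simp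
  then show ?thesis
    by (rule halfline.is_laplace_cong) (simp add: True)
next
  case False
  with \<alpha> have \<alpha>: "0 < \<alpha>" "\<alpha> < 1"
    by simp_all
  show ?thesis
  proof (rule halfline_laplace_continuity)
    show "halfline.is_laplace (stable_approx \<alpha> n)" for n
      by (rule is_laplace_stable_approx[OF \<alpha>])
    show "stable_approx \<alpha> n 0 = 1" for n
      using \<alpha> by (simp add: stable_approx_def)
    show "\<exists>u>0. \<forall>n. 1 - \<epsilon> < stable_approx \<alpha> n u" if "0 < \<epsilon>" for \<epsilon>
    proof -
      have "(\<lambda>m. exp (- (inverse (real (Suc m)) powr \<alpha>))) \<longlonglongrightarrow> exp (- (0 powr \<alpha>))"
        using \<alpha> by (intro tendsto_exp tendsto_minus tendsto_powr' LIMSEQ_inverse_real_of_nat tendsto_const) simp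
      then have "eventually (\<lambda>m. 1 - \<epsilon> < exp (- (inverse (real (Suc m)) powr \<alpha>))) sequentially"
        using \<open>0 < \<epsilon>\<close> \<alpha> by (intro order_tendstoD(1)) auto
      then obtain m where m: "1 - \<epsilon> < exp (- (inverse (real (Suc m)) powr \<alpha>))"
        by (auto simp: eventually_sequentially)
      define u where "u = inverse (real (Suc m))"
      have "0 < u"
        by (simp add: u_def)
      have "exp (- (u powr \<alpha>)) \<le> stable_approx \<alpha> n u" for n
        unfolding stable_approx_def using \<open>0 < u\<close> \<alpha>
        by (simp del: of_nat_Suc add: powr_mono2 scaled_one_minus_exp_bounds(2))
      then show ?thesis
        using m \<open>0 < u\<close> unfolding u_def[symmetric] by (meson less_le_trans)
    qed
    show "(\<lambda>n. stable_approx \<alpha> n u) \<longlonglongrightarrow> exp (- (u powr \<alpha>))" if u: "0 \<le> u" for u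
    proof -
      have "(\<lambda>n. u / (1 + u * inverse (real (Suc n)))) \<longlonglongrightarrow> u / (1 + u * 0)"
        by (intro tendsto_intros LIMSEQ_inverse_real_of_nat) simp
      then have "(\<lambda>n. u / (1 + u / real (Suc n))) \<longlonglongrightarrow> u"
        by (simp add: divide_inverse)
      then have "(\<lambda>n. real (Suc n) * (1 - exp (- (u / real (Suc n))))) \<longlonglongrightarrow> u"
        by (rule tendsto_sandwich[OF _ _ _ tendsto_const, rotated 2])
           (intro always_eventually allI scaled_one_minus_exp_bounds[OF u])+
      then show ?thesis
        unfolding stable_approx_def using \<alpha> u
        by (intro tendsto_exp tendsto_minus tendsto_powr' tendsto_const) (auto intro!: always_eventually)
    qed
  qed
qed

section \<open>Stable time change of a random vector\<close>

lemma borel_measurable_vec_lambda: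
  fixes f :: "'a \<Rightarrow> 'n::finite \<Rightarrow> real"
  assumes "\<And>k. (\<lambda>x. f x k) \<in> borel_measurable M"
  shows "(\<lambda>x. \<chi> k. f x k) \<in> borel_measurable M"
proof (rule borel_measurable_euclidean_space[THEN iffD2], rule ballI)
  fix b :: "real ^ 'n" assume "b \<in> Basis"
  then obtain k where "b = axis k 1"
    by (auto simp: Basis_vec_def)
  then show "(\<lambda>x. (\<chi> k. f x k) \<bullet> b) \<in> borel_measurable M"
    using assms[of k] by (simp add: inner_axis)
qed

text \<open>
  If \<open>W\<close> has transform \<open>f\<close> (up to normalization of the measure) and, independently, \<open>S\<^sub>k\<close> are independent one-sided stable variables of index
  \<open>\<alpha> $ k\<close>, then the vector with the components \<open>(W $ k) powr (1 / \<alpha> $ k) * S\<^sub>k\<close> has the required transform: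
  given \<open>W\<close>, the expectation factorizes, and the scaling turns \<open>exp (- (a powr \<alpha> $ k))\<close> at
  \<open>a = u $ k * (W $ k) powr (1 / \<alpha> $ k)\<close> into \<open>exp (- (u $ k powr \<alpha> $ k * W $ k))\<close>.
\<close>

lemma is_laplace_vec_powr:
  fixes \<alpha> :: "real ^ 'n"
  assumes f: "orthant.is_laplace f" and \<alpha>: "\<And>k. 0 < \<alpha> $ k \<and> \<alpha> $ k \<le> 1"
  shows "orthant.is_laplace (\<lambda>u. f (vec_powr u \<alpha>))"
proof -
  obtain M where M: "orthant.laplace_of M f"
    using f unfolding orthant.is_laplace_def by blast
  have "\<exists>N. halfline.laplace_of N (\<lambda>u. exp (- (u powr \<alpha> $ k)))" for k
    using is_laplace_stable \<alpha>[of k] unfolding halfline.is_laplace_def by blast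
  then obtain N where N: "\<And>k. halfline.laplace_of (N k) (\<lambda>u. exp (- (u powr \<alpha> $ k)))"
    by metis
  interpret M: finite_measure M
    by (rule orthant.laplace_of_finite_measure[OF M])
  interpret N: prob_space "N k" for k
    by (rule halfline.laplace_of_prob_space[OF N]) simp
  interpret product_sigma_finite N
    by standard
  let ?S = "Pi\<^sub>M UNIV N"
  interpret S: prob_space ?S
    by (rule prob_space_PiM) (rule N.prob_space_axioms)
  have sets [measurable_cong]: "sets M = sets borel" "\<And>k. sets (N k) = sets borel"
    using M N by (simp_all add: orthant.laplace_of_def halfline.laplace_of_def)
  \<comment> \<open>Truncation at \<open>0\<close> puts every value of \<open>Y\<close> into the orthant; it changes \<open>Y\<close> only on a null set.\<close>
  define Y :: "(real ^ 'n) \<times> ('n \<Rightarrow> real) \<Rightarrow> real ^ 'n"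
    where "Y = (\<lambda>(w, s). \<chi> k. max 0 (w $ k) powr (1 / \<alpha> $ k) * max 0 (s k))"
  have Y_measurable [measurable]: "Y \<in> borel_measurable (M \<Otimes>\<^sub>M ?S)"
    unfolding Y_def split_beta by (rule borel_measurable_vec_lambda) measurable
  have "Y p \<in> nonneg_orthant" for p
    by (simp add: Y_def nonneg_orthant_def split_beta)
  then have "AE x in distr (M \<Otimes>\<^sub>M ?S) borel Y. x \<in> nonneg_orthant"
    by (subst AE_distr_iff) auto
  moreover have "0 \<le> f (vec_powr u \<alpha>) \<and>
      (\<integral>\<^sup>+x. ennreal (exp (- (u \<bullet> x))) \<partial>distr (M \<Otimes>\<^sub>M ?S) borel Y) = ennreal (f (vec_powr u \<alpha>))"
    if u: "u \<in> nonneg_orthant" for u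
  proof
    have u_nonneg: "0 \<le> u $ k" for k
      using u by (simp add: nonneg_orthant_def)
    have powr_u: "vec_powr u \<alpha> \<in> nonneg_orthant"
      by (simp add: vec_powr_def nonneg_orthant_def)
    then show "0 \<le> f (vec_powr u \<alpha>)"
      by (rule orthant.is_laplace_nonneg[OF f])
    have stable: "(\<integral>\<^sup>+s. ennreal (exp (- (a * max 0 s))) \<partial>N k) = ennreal (exp (- (a powr \<alpha> $ k)))"
      if "0 \<le> a" for a k
    proof -
      have "AE s in N k. 0 \<le> s"
        using N[of k] by (simp add: halfline.laplace_of_def)
      then have "AE s in N k. ennreal (exp (- (a * max 0 s))) = ennreal (exp (- (a * s)))"
        by eventually_elim simp
      then have "(\<integral>\<^sup>+s. ennreal (exp (- (a * max 0 s))) \<partial>N k) = (\<integral>\<^sup>+s. ennreal (exp (- (a * s))) \<partial>N k)"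
        by (rule nn_integral_cong_AE)
      then show ?thesis
        using N[of k] that by (simp add: halfline.laplace_of_def)
    qed
    have inner_integral: "(\<integral>\<^sup>+s. ennreal (exp (- (u \<bullet> Y (w, s)))) \<partial>?S)
        = ennreal (exp (- (vec_powr u \<alpha> \<bullet> w)))" if w: "w \<in> nonneg_orthant" for w
    proof -
      define a where "a k = u $ k * w $ k powr (1 / \<alpha> $ k)" for k
      have w_nonneg: "0 \<le> w $ k" for k
        using w by (simp add: nonneg_orthant_def)
      have a_nonneg: "0 \<le> a k" for k
        by (simp add: a_def u_nonneg)
      have a_powr: "a k powr \<alpha> $ k = u $ k powr \<alpha> $ k * w $ k" for k
      proof -
        have "\<alpha> $ k \<noteq> 0"
          using \<alpha>[of k] by simp
        then show ?thesis
          by (simp add: a_def powr_mult powr_powr u_nonneg w_nonneg)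
      qed
      have "exp (- (u \<bullet> Y (w, s))) = (\<Prod>k\<in>UNIV. exp (- (a k * max 0 (s k))))" for s
      proof -
        have "- (u \<bullet> Y (w, s)) = (\<Sum>k\<in>UNIV. - (a k * max 0 (s k)))"
          by (simp add: inner_vec_def Y_def a_def w_nonneg max_absorb2 mult.assoc sum_negf)
        then show ?thesis
          by (simp only: exp_sum[OF finite])
      qed
      then have "(\<integral>\<^sup>+s. ennreal (exp (- (u \<bullet> Y (w, s)))) \<partial>?S)
          = (\<integral>\<^sup>+s. (\<Prod>k\<in>UNIV. ennreal (exp (- (a k * max 0 (s k))))) \<partial>?S)"
        by (simp add: prod_ennreal)
      also have "\<dots> = (\<Prod>k\<in>UNIV. \<integral>\<^sup>+s. ennreal (exp (- (a k * max 0 s))) \<partial>N k)"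
        by (rule product_nn_integral_prod[OF finite]) measurable
      also have "\<dots> = ennreal (\<Prod>k\<in>UNIV. exp (- (u $ k powr \<alpha> $ k * w $ k)))"
        by (simp add: stable a_nonneg a_powr prod_ennreal)
      also have "(\<Prod>k\<in>UNIV. exp (- (u $ k powr \<alpha> $ k * w $ k))) = exp (- (vec_powr u \<alpha> \<bullet> w))"
        by (simp add: exp_sum[symmetric] inner_vec_def vec_powr_def sum_negf)
      finally show ?thesis .
    qed
    have "(\<integral>\<^sup>+x. ennreal (exp (- (u \<bullet> x))) \<partial>distr (M \<Otimes>\<^sub>M ?S) borel Y)
        = (\<integral>\<^sup>+w. \<integral>\<^sup>+s. ennreal (exp (- (u \<bullet> Y (w, s)))) \<partial>?S \<partial>M)"
      by (subst nn_integral_distr) (simp_all add: S.nn_integral_fst[symmetric])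
    also have "\<dots> = (\<integral>\<^sup>+w. ennreal (exp (- (vec_powr u \<alpha> \<bullet> w))) \<partial>M)"
    proof (rule nn_integral_cong_AE)
      have "AE w in M. w \<in> nonneg_orthant"
        using M by (simp add: orthant.laplace_of_def)
      then show "AE w in M. (\<integral>\<^sup>+s. ennreal (exp (- (u \<bullet> Y (w, s)))) \<partial>?S)
          = ennreal (exp (- (vec_powr u \<alpha> \<bullet> w)))"
        by eventually_elim (rule inner_integral)
    qed
    also have "\<dots> = ennreal (f (vec_powr u \<alpha>))"
      using M powr_u by (simp add: orthant.laplace_of_def)
    finally show "(\<integral>\<^sup>+x. ennreal (exp (- (u \<bullet> x))) \<partial>distr (M \<Otimes>\<^sub>M ?S) borel Y)
        = ennreal (f (vec_powr u \<alpha>))" .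
  qed
  ultimately have "orthant.laplace_of (distr (M \<Otimes>\<^sub>M ?S) borel Y) (\<lambda>u. f (vec_powr u \<alpha>))"
    unfolding orthant.laplace_of_def by simp
  then show ?thesis
    unfolding orthant.is_laplace_def by blast
qed

text \<open>
  The random vector has to take all of its values in the orthant, so the identity is
  redefined as \<open>0\<close> on the null set outside.
\<close>

lemma multidim_laplace_transformI:
  fixes f :: "real ^ 'n \<Rightarrow> real"
  assumes f: "orthant.is_laplace f" and f0: "f 0 = 1"
  shows "multidim_laplace_transform f"
proof -
  obtain N where N: "orthant.laplace_of N f"
    using f unfolding orthant.is_laplace_def by blast
  have [measurable_cong]: "sets N = sets borel"
    using N by (simp add: orthant.laplace_of_def)
  define X :: "real ^ 'n \<Rightarrow> real ^ 'n" where "X x = (if x \<in> nonneg_orthant then x else 0)" for x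
  have X [measurable]: "X \<in> borel_measurable N"
    unfolding X_def by measurable
  have "f u = (\<integral>x. exp (- (u \<bullet> X x)) \<partial>N)" if u: "u \<in> nonneg_orthant" for u
  proof -
    have "AE x in N. x \<in> nonneg_orthant"
      using N by (simp add: orthant.laplace_of_def)
    then have "AE x in N. exp (- (u \<bullet> X x)) = exp (- (u \<bullet> x))"
      by eventually_elim (simp add: X_def)
    then have "(\<integral>x. exp (- (u \<bullet> X x)) \<partial>N) = (\<integral>x. exp (- (u \<bullet> x)) \<partial>N)"
      by (intro integral_cong_AE) simp_all
    then show ?thesis
      using orthant.laplace_of_integral(2)[OF N u] by simp
  qed
  moreover have "X x \<in> nonneg_orthant" for x
    by (simp add: X_def orthant.zero_in_C)
  ultimately show ?thesis
    using orthant.laplace_of_prob_space[OF N f0] X unfolding multidim_laplace_transform_def by blast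
qed

theorem theorem3:
  fixes \<pi> :: "real ^ 'p" and T :: "real ^ 'p ^ 'p" and R :: "real ^ 'n ^ 'p" and \<alpha> :: "real ^ 'n"
  assumes "MPH_star_representation \<pi> T R"
    and "\<And>k. 0 < \<alpha> $ k \<and> \<alpha> $ k \<le> 1"
  shows "multidim_laplace_transform
    (\<lambda>u. (\<pi> v* matrix_inv (diag_matrix (R *v vec_powr u \<alpha>) - T)) \<bullet> exit_vector T)"
proof (rule multidim_laplace_transformI)
  show "orthant.is_laplace
      (\<lambda>u. (\<pi> v* matrix_inv (diag_matrix (R *v vec_powr u \<alpha>) - T)) \<bullet> exit_vector T)"
    using is_laplace_vec_powr[OF is_laplace_MPH_star(1)[OF assms(1)] assms(2)] .
  have "vec_powr 0 \<alpha> = 0"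
    by (simp add: vec_powr_def vec_eq_iff)
  then show "(\<pi> v* matrix_inv (diag_matrix (R *v vec_powr 0 \<alpha>) - T)) \<bullet> exit_vector T = 1"
    using is_laplace_MPH_star(2)[OF assms(1)] by simp
qed

end
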